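(* Let $m$ be a positive integer. Then for every positive integer $n>\dfrac{14.4}{\left(\sqrt[m]{2}-\sqrt[m]{1.5}\right)^m}$ there exist a prime number $r$ and a positive integer $a$ such that $n<r<\frac{3n}{2}<a^m<2n$.
   Context: $\sqrt[m]{x}$ denotes the positive real $m$-th root of a positive real number $x$. All inequalities are strict. *)

theory Defs
  imports Complex_Main "HOL-Computational_Algebra.Primes"
begin

end

theory Submission
  imports Defs "HOL-Number_Theory.Prime_Powers" "HOL-Number_Theory.Pocklington"
begin

text \<open>
  The gap between the \<open>m\<close>-th roots of \<open>3n/2\<close> and \<open>2n\<close> exceeds \<open>1\<close>, which yields \<open>a\<close>;
  moreover \<open>n\<close> exceeds \<open>14.4\<close>, and for every \<open>n \<ge> 8\<close> there is a prime strictly between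
  \<open>n\<close> and \<open>3n/2\<close>. The latter follows from Chebyshev's estimates: with \<open>T(x) = ln \<lfloor>x\<rfloor>!\<close>, the
  combination \<open>T(x) - T(x/2) - T(x/3) - T(x/5) + T(x/30)\<close> is at most \<open>\<psi>(x)\<close> and at least
  \<open>\<psi>(x) - \<psi>(x/6)\<close>, while it equals \<open>Ax + O(ln x)\<close> by Stirling. Hence \<open>\<psi>(x)\<close> lies between
  \<open>Ax\<close> and \<open>6Ax/5\<close> up to logarithmic errors. As \<open>3/2 > 6/5\<close>, \<open>\<psi>\<close> grows linearly from \<open>n\<close> to
  \<open>3n/2\<close>, whereas proper prime powers contribute only \<open>O(\<surd>n ln n)\<close>. For \<open>n < 10000\<close> a
  chain of primes with ratios below \<open>3/2\<close> suffices.
\<close>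

section \<open>Chebyshev's identity linking factorials and \<open>mangoldt\<close>\<close>

definition chebyshev_psi :: "nat \<Rightarrow> real" where
  "chebyshev_psi n = (\<Sum>d=1..n. mangoldt d)"

text \<open>Swap the sums in \<open>ln k\<close> = sum of \<open>mangoldt d\<close> over
  \<open>d dvd k\<close>; \<open>n div d\<close> counts the multiples of \<open>d\<close> up to
  \<open>n\<close>. The bound \<open>N\<close> is free because terms with \<open>d > n\<close>
  vanish, so factorials of different sizes can share one summation range.\<close>

lemma ln_fact_eq_sum_mangoldt:
  assumes "n \<le> N"
  shows "ln (fact n) = (\<Sum>d=1..N. mangoldt d * real (n div d))"
proof -
  have count: "(\<Sum>k=1..n. if d dvd k then (1::real) else 0) = real (n div d)" if "d \<in> {1..N}" for d
  proof -
    have d: "d > 0" using that by simp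
    have "{k \<in> {1..n}. d dvd k} = (\<lambda>j. d * j) ` {1..n div d}"
    proof (intro equalityI subsetI)
      fix k assume k: "k \<in> {k \<in> {1..n}. d dvd k}"
      then obtain j where j: "k = d * j" by (auto elim: dvdE)
      have "j \<le> n div d" using k j d by (simp add: less_eq_div_iff_mult_less_eq mult.commute)
      moreover have "j \<ge> 1" using k j by (cases j) auto
      ultimately show "k \<in> (\<lambda>j. d * j) ` {1..n div d}" using j by auto
    next
      fix k assume "k \<in> (\<lambda>j. d * j) ` {1..n div d}"
      then obtain j where "k = d * j" "1 \<le> j" "j \<le> n div d" by fastforce
      then show "k \<in> {k \<in> {1..n}. d dvd k}"
        using d by (auto simp: less_eq_div_iff_mult_less_eq mult.commute)
    qed
    moreover have "card ((\<lambda>j. d * j) ` {1..n div d}) = n div d"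
      using d by (subst card_image) (auto simp: inj_on_def)
    moreover have "(\<Sum>k=1..n. if d dvd k then (1::real) else 0) = real (card {k \<in> {1..n}. d dvd k})"
      by (subst sum.inter_filter[symmetric]) auto
    ultimately show ?thesis by simp
  qed
  have "ln (fact n :: real) = (\<Sum>k=1..n. ln (real k))"
    unfolding fact_prod of_nat_prod by (subst ln_prod) auto
  also have "\<dots> = (\<Sum>k=1..n. \<Sum>d=1..N. if d dvd k then mangoldt d else 0)"
  proof (rule sum.cong[OF refl])
    fix k assume k: "k \<in> {1..n}"
    have "ln (real k) = (\<Sum>d | d dvd k. mangoldt d)"
      using mangoldt_sum[of k, where ?'a = real] k by simp
    also have "{d. d dvd k} = {d \<in> {1..N}. d dvd k}"
      using k assms by (auto dest: dvd_imp_le intro!: Nat.gr0I simp: Suc_le_eq)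
    finally show "ln (real k) = (\<Sum>d=1..N. if d dvd k then mangoldt d else 0)"
      by (simp only: sum.inter_filter finite_atLeastAtMost)
  qed
  also have "\<dots> = (\<Sum>d=1..N. \<Sum>k=1..n. if d dvd k then mangoldt d else 0)"
    by (rule sum.swap)
  also have "\<dots> = (\<Sum>d=1..N. mangoldt d * (\<Sum>k=1..n. if d dvd k then 1 else 0))"
    by (simp add: sum_distrib_left if_distrib cong: if_cong)
  also have "\<dots> = (\<Sum>d=1..N. mangoldt d * real (n div d))"
    by (intro sum.cong refl arg_cong2[where f = "(*)"] count)
  finally show ?thesis .
qed

definition chebyshev_sum :: "nat \<Rightarrow> real" where
  "chebyshev_sum n = ln (fact n) - ln (fact (n div 2)) - ln (fact (n div 3))
     - ln (fact (n div 5)) + ln (fact (n div 30))"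

text \<open>At \<open>y = n div d\<close> this is the coefficient of \<open>mangoldt d\<close> in
  \<open>chebyshev_sum n\<close>; it is integer-valued to avoid truncated subtraction.\<close>

definition chebyshev_coeff :: "nat \<Rightarrow> int" where
  "chebyshev_coeff y = int y - int (y div 2) - int (y div 3) - int (y div 5) + int (y div 30)"

text \<open>Since 30 - 15 - 10 - 6 + 1 = 0, the coefficient is periodic with period 30, so checking
  the 30 residues suffices.\<close>

lemma chebyshev_coeff_range: "chebyshev_coeff y \<in> {0, 1}"
proof -
  define q s where "q = y div 30" and "s = y mod 30"
  have y: "y = 30 * q + s" by (simp add: q_def s_def)
  have "s \<in> {..<30}" by (simp add: s_def)
  also have "{..<30} = {0,1,2,3,4,5,6,7,8,9,10,11,12,13,14,15,16,17,18,19,20,21,22,23,24,25,26,27,28,29::nat}"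
    by (auto simp: lessThan_nat_numeral)
  finally have "int s - int (s div 2) - int (s div 3) - int (s div 5) \<in> {0, 1}"
    by (elim insertE emptyE) simp_all
  moreover have "y div 2 = 15 * q + s div 2" "y div 3 = 10 * q + s div 3" "y div 5 = 6 * q + s div 5"
    unfolding y by linarith+
  ultimately show ?thesis
    unfolding chebyshev_coeff_def q_def[symmetric] by (auto simp: y)
qed

lemma chebyshev_coeff_small: "1 \<le> y \<Longrightarrow> y < 6 \<Longrightarrow> chebyshev_coeff y = 1"
proof -
  assume "1 \<le> y" "y < 6"
  then have "y \<in> {1,2,3,4,5}" by auto
  then show ?thesis by (auto simp: chebyshev_coeff_def)
qed

lemma chebyshev_sum_eq:
  "chebyshev_sum n = (\<Sum>d=1..n. mangoldt d * of_int (chebyshev_coeff (n div d)))"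
proof -
  \<comment> \<open>Nested floors commute: both \<open>n div k div d\<close> and
    \<open>n div d div k\<close> equal \<open>n div (k * d)\<close>.\<close>
  have T: "ln (fact (n div k)) = (\<Sum>d=1..n. mangoldt d * real (n div d div k))" for k
    by (subst ln_fact_eq_sum_mangoldt[of _ n]) (simp_all add: div_mult2_eq[symmetric] mult.commute)
  show ?thesis
    unfolding chebyshev_sum_def T T[of 1, unfolded div_by_1] chebyshev_coeff_def
    by (simp add: algebra_simps sum.distrib sum_subtractf)
qed

lemma chebyshev_sum_le_psi: "chebyshev_sum n \<le> chebyshev_psi n"
  unfolding chebyshev_sum_eq chebyshev_psi_def
proof (rule sum_mono)
  fix d
  show "mangoldt d * of_int (chebyshev_coeff (n div d)) \<le> (mangoldt d :: real)"
    using chebyshev_coeff_range[of "n div d"] mangoldt_nonneg[of d] by auto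
qed

lemma psi_le_chebyshev_sum: "chebyshev_psi n \<le> chebyshev_sum n + chebyshev_psi (n div 6)"
proof -
  have "chebyshev_psi n - chebyshev_psi (n div 6) = (\<Sum>d\<in>{1..n} - {1..n div 6}. mangoldt d)"
    unfolding chebyshev_psi_def by (subst sum_diff) auto
  also have "\<dots> = (\<Sum>d\<in>{1..n} - {1..n div 6}. mangoldt d * of_int (chebyshev_coeff (n div d)))"
  proof (rule sum.cong[OF refl])
    fix d assume d: "d \<in> {1..n} - {1..n div 6}"
    then have "1 \<le> n div d" by (simp add: less_eq_div_iff_mult_less_eq)
    moreover have "n div d < 6"
      using d by (auto simp: div_less_iff_less_mult mult.commute not_le)
    ultimately show "mangoldt d = (mangoldt d * of_int (chebyshev_coeff (n div d)) :: real)"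
      by (simp add: chebyshev_coeff_small)
  qed
  also have "\<dots> \<le> chebyshev_sum n"
    unfolding chebyshev_sum_eq
  proof (rule sum_mono2)
    fix d
    show "0 \<le> (mangoldt d * of_int (chebyshev_coeff (n div d)) :: real)"
      using chebyshev_coeff_range[of "n div d"] mangoldt_nonneg[of d] by auto
  qed auto
  finally show ?thesis by simp
qed

section \<open>Stirling-type bounds for logarithms of factorials\<close>

definition xlnx :: "real \<Rightarrow> real" where
  "xlnx x = x * ln x - x"

lemma xlnx_ge: "x > 0 \<Longrightarrow> xlnx x \<ge> -1"
  using ln_le_minus_one[of "1/x"] by (simp add: xlnx_def ln_div field_simps)

text \<open>The derivative of \<open>xlnx\<close> is \<open>ln\<close>, nonnegative from 1 on; here
  \<open>xlnx y - xlnx x \<ge> (y - x) * ln x\<close> replaces calculus.\<close>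

lemma xlnx_mono:
  assumes "1 \<le> x" "x \<le> y"
  shows "xlnx x \<le> xlnx y"
proof -
  have "ln (x / y) \<le> x / y - 1" using assms by (intro ln_le_minus_one) auto
  then have "y * ln x + y \<le> y * ln y + x" using assms by (simp add: ln_div field_simps)
  moreover have "0 \<le> (y - x) * ln x" using assms by simp
  ultimately show ?thesis by (simp add: xlnx_def algebra_simps)
qed

lemma ln_fact_ge: "n \<ge> 1 \<Longrightarrow> ln (fact n) \<ge> xlnx (real n) + 1"
proof (induction n rule: dec_induct)
  case base
  show ?case by (simp add: xlnx_def)
next
  case (step n)
  have "ln ((real n + 1) / n) \<le> (real n + 1) / n - 1" using step by (intro ln_le_minus_one) auto
  then have "n * ln (real n + 1) \<le> n * ln n + 1" using step by (simp add: ln_div field_simps)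
  moreover have "ln (fact (Suc n)) = ln (real n + 1) + ln (fact n)"
    by (simp add: ln_mult add.commute)
  ultimately show ?case using step.IH by (simp add: xlnx_def algebra_simps)
qed

lemma ln_fact_le: "n \<ge> 1 \<Longrightarrow> ln (fact n) \<le> xlnx (real n) + 1 + ln (real n)"
proof (induction n rule: dec_induct)
  case base
  show ?case by (simp add: xlnx_def)
next
  case (step n)
  have "ln (n / (real n + 1)) \<le> n / (real n + 1) - 1" using step by (intro ln_le_minus_one) auto
  then have "(real n + 1) * ln n + 1 \<le> (real n + 1) * ln (real n + 1)"
    using step by (simp add: ln_div field_simps)
  moreover have "ln (fact (Suc n)) = ln (real n + 1) + ln (fact n)"
    by (simp add: ln_mult add.commute)
  ultimately show ?case using step.IH by (simp add: xlnx_def algebra_simps)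
qed

text \<open>Rounding \<open>n / k\<close> down costs at most one logarithm. The error is stated with
  \<open>ln (real n + 1)\<close>, independent of \<open>k\<close>, so that the bounds for several
  \<open>k\<close> add up.\<close>

lemma ln_fact_div_bounds:
  assumes "n > 0" "k > 0"
  shows "xlnx (real n / k) - ln (real n + 1) \<le> ln (fact (n div k))"
    and "ln (fact (n div k)) \<le> xlnx (real n / k) + 1 + ln (real n + 1)"
proof -
  define x where "x = real n / k"
  define q where "q = n div k"
  have x: "x > 0" using assms by (simp add: x_def)
  have "n < k * (q + 1)" using assms dividend_less_times_div[of k n] by (simp add: q_def)
  then have "real n < real (k * (q + 1))" by (rule less_imp_of_nat_less)
  then have xq: "x < real q + 1" using assms by (simp add: x_def field_simps)
  have "q * k \<le> n" by (simp add: q_def)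
  then have "real (q * k) \<le> real n" by (rule of_nat_mono)
  then have qx: "real q \<le> x" using assms by (simp add: x_def field_simps)
  have qn: "q \<le> n" by (simp add: q_def)
  have ln_n: "ln (real q + 1) \<le> ln (real n + 1)" using qn by simp
  have ln_nn: "0 \<le> ln (real n + 1)" by simp
  have "xlnx x - ln (real n + 1) \<le> ln (fact q) \<and> ln (fact q) \<le> xlnx x + 1 + ln (real n + 1)"
  proof (cases "q = 0")
    case True
    \<comment> \<open>Here \<open>x < 1\<close>, so \<open>xlnx x\<close> lies between -1 and 0,
      while the factorial is 1.\<close>
    then have "x * ln x \<le> 0" using x xq by (simp add: mult_le_0_iff)
    then have "xlnx x \<le> 0" unfolding xlnx_def using x by linarith
    then show ?thesis using xlnx_ge[OF x] True ln_nn by (simp only: fact_0 ln_one) linarith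
  next
    case False
    have "ln (real q) \<le> ln (real q + 1)" using False by simp
    moreover have "xlnx (real q) \<le> xlnx x" using False qx by (intro xlnx_mono) auto
    moreover have "xlnx x \<le> xlnx (real q + 1)" using False qx xq by (intro xlnx_mono) auto
    moreover have "ln (fact (Suc q)) = ln (real q + 1) + ln (fact q)"
      by (simp add: ln_mult add.commute)
    moreover have "xlnx (real q + 1) + 1 \<le> ln (fact (Suc q))"
      using ln_fact_ge[of "Suc q"] by (simp add: add.commute)
    moreover have "ln (fact q) \<le> xlnx (real q) + 1 + ln (real q)"
      using ln_fact_le[of q] False by simp
    ultimately show ?thesis using ln_n by linarith
  qed
  then show "xlnx (real n / k) - ln (real n + 1) \<le> ln (fact (n div k))"
    and "ln (fact (n div k)) \<le> xlnx (real n / k) + 1 + ln (real n + 1)"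
    by (simp_all add: x_def q_def)
qed

section \<open>Chebyshev's linear bounds for \<open>chebyshev_psi\<close>\<close>

definition chebyshev_const :: real where
  "chebyshev_const = ln 2 / 2 + ln 3 / 3 + ln 5 / 5 - ln 30 / 30"

text \<open>The true value is about 0.921. The comparisons \<open>exp 1 \<le> 3\<close>, 3^5 < 2^8
  and 3 * 2^3 < 5^2 bound all logarithms below by multiples of \<open>ln 3 \<ge> 1\<close>.\<close>

lemma chebyshev_const_ge: "chebyshev_const \<ge> 4/5"
proof -
  have l3: "ln 3 \<ge> (1::real)" using exp_le by (subst ln_ge_iff) auto
  have "5 * ln 3 = ln ((3::real) ^ 5)" by (subst ln_realpow) auto
  also have "\<dots> \<le> ln (2 ^ 8)" by (subst ln_le_cancel_iff) auto
  also have "\<dots> = 8 * ln (2::real)" by (subst ln_realpow) auto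
  finally have l2: "5 * ln 3 \<le> 8 * ln (2::real)" .
  have "ln 3 + 3 * ln 2 = ln (3 * 2 ^ 3 :: real)" 
    using ln_realpow[of 2 3] by (subst ln_mult_pos) simp_all
  also have "\<dots> \<le> ln (5 ^ 2)" by (subst ln_le_cancel_iff) auto
  also have "\<dots> = 2 * ln (5::real)" by (subst ln_realpow) auto
  finally have l5: "ln 3 + 3 * ln 2 \<le> 2 * ln (5::real)" .
  have "ln (30::real) = ln (2 * 3 * 5)" by simp
  also have "\<dots> = ln 2 + ln 3 + ln (5::real)" by (subst ln_mult_pos, simp, simp)+ simp
  finally show ?thesis using l2 l3 l5 unfolding chebyshev_const_def by (simp add: field_simps)
qed

lemma chebyshev_sum_bounds:
  assumes "n > 0"
  shows "chebyshev_const * n - 5 * ln (real n + 1) - 3 \<le> chebyshev_sum n"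
    and "chebyshev_sum n \<le> chebyshev_const * n + 5 * ln (real n + 1) + 2"
proof -
  \<comment> \<open>As 1 - 1/2 - 1/3 - 1/5 + 1/30 = 0, the terms in \<open>n * ln n\<close> and the
    linear terms of \<open>xlnx\<close> cancel, leaving only the \<open>ln k / k\<close>. The
    constants 3 and 2 below count the negative and the positive summands.\<close>
  have "xlnx (real n / 1) - xlnx (real n / 2) - xlnx (real n / 3) - xlnx (real n / 5)
      + xlnx (real n / 30) = chebyshev_const * n"
    using assms by (simp add: xlnx_def chebyshev_const_def ln_div field_simps)
  then show "chebyshev_const * n - 5 * ln (real n + 1) - 3 \<le> chebyshev_sum n"
    and "chebyshev_sum n \<le> chebyshev_const * n + 5 * ln (real n + 1) + 2"
    using ln_fact_div_bounds[OF assms, of 1] ln_fact_div_bounds[OF assms, of 2]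
      ln_fact_div_bounds[OF assms, of 3] ln_fact_div_bounds[OF assms, of 5]
      ln_fact_div_bounds[OF assms, of 30]
    unfolding chebyshev_sum_def by simp_all
qed

lemma chebyshev_psi_ge:
  "n > 0 \<Longrightarrow> chebyshev_const * n - 5 * ln (real n + 1) - 3 \<le> chebyshev_psi n"
  using chebyshev_sum_bounds(1) chebyshev_sum_le_psi order_trans by blast

text \<open>Iterating \<open>psi_le_chebyshev_sum\<close> gives the factor 1 + 1/6 + 1/36 + ... =
  6/5. For \<open>n \<ge> 6\<close> each passage to \<open>n div 6\<close> lowers
  \<open>ln (real n + 1)\<close> by at least 1, so the error \<open>5 * l + 2\<close> occurs at most
  \<open>1 + l\<close> times.\<close>

lemma chebyshev_psi_le:
  "chebyshev_psi n \<le> 6/5 * chebyshev_const * n + (5 * ln (real n + 1) + 2) * (1 + ln (real n + 1))"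
proof (induction n rule: less_induct)
  case (less n)
  define l where "l = ln (real n + 1)"
  have l: "l \<ge> 0" by (simp add: l_def)
  have c: "chebyshev_const > 0" using chebyshev_const_ge by simp
  show ?case
  proof (cases "n < 6")
    case True
    have "chebyshev_psi n \<le> chebyshev_const * n + 5 * l + 2"
    proof (cases "n = 0")
      case False
      then show ?thesis
        using psi_le_chebyshev_sum[of n] chebyshev_sum_bounds(2)[of n] True
        by (simp add: chebyshev_psi_def l_def)
    qed (use l in \<open>simp add: chebyshev_psi_def\<close>)
    moreover have "0 \<le> (5 * l + 2) * l" using l by simp
    moreover have "chebyshev_const * n \<le> 6/5 * chebyshev_const * n" using c by simp
    ultimately show ?thesis unfolding l_def[symmetric] by (simp add: algebra_simps)
  next
    case False
    define k where "k = n div 6"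
    define l' where "l' = ln (real k + 1)"
    have "6 * k \<le> n" by (simp add: k_def)
    then have k: "real k \<le> real n / 6" by linarith
    have "3 * (real k + 1) \<le> real n + 1" using k False by simp
    then have "exp 1 * (real k + 1) \<le> real n + 1"
      using exp_le mult_right_mono[of "exp 1" 3 "real k + 1"] by linarith
    then have "ln (exp 1 * (real k + 1)) \<le> l"
      unfolding l_def by (subst ln_le_cancel_iff) auto
    then have l': "l' \<le> l - 1" by (simp add: l'_def ln_mult)
    have l'0: "l' \<ge> 0" by (simp add: l'_def)
    have "chebyshev_psi n \<le> chebyshev_const * n + 5 * l + 2 + chebyshev_psi k"
      using psi_le_chebyshev_sum[of n] chebyshev_sum_bounds(2)[of n] False
      by (simp add: k_def l_def)
    also have "chebyshev_psi k \<le> 6/5 * chebyshev_const * k + (5 * l' + 2) * (1 + l')"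
      unfolding l'_def using False by (intro less) (simp add: k_def)
    also have "6/5 * chebyshev_const * k \<le> 6/5 * chebyshev_const * (n / 6)"
      using c k by (intro mult_left_mono) auto
    also have "(5 * l' + 2) * (1 + l') \<le> (5 * l + 2) * l"
      using l' l'0 by (intro mult_mono) auto
    finally show ?thesis unfolding l_def[symmetric] by (simp add: algebra_simps)
  qed
qed

section \<open>Primes strictly between \<open>n\<close> and \<open>3n/2\<close>\<close>

text \<open>Since \<open>N < 2n\<close>, at most one power of each prime lies in \<open>{n<..N}\<close>.\<close>
lemma chebyshev_psi_diff_le_if_no_prime:
  assumes "n \<le> N" "N < 2 * n" and no_prime: "\<And>p. prime p \<Longrightarrow> n < p \<Longrightarrow> N < p"
  shows "chebyshev_psi N - chebyshev_psi n \<le> sqrt N * (ln N / 2)"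
proof -
  define D where "D = {d \<in> {n<..N}. primepow d}"
  have np: "\<not> prime d" if "d \<in> D" for d
    using no_prime[of d] that by (auto simp: D_def)
  \<comment> \<open>With no prime in the interval, every prime power there has exponent at least 2,
    so its base is at most \<open>sqrt N\<close>.\<close>
  have *: "p \<ge> 1 \<and> p ^ 2 \<le> N" if p_in: "p \<in> aprimedivisor ` D" for p
  proof -
    obtain d where d: "d \<in> D" "p = aprimedivisor d" using p_in by blast
    have p: "p > 1" using d primepow_gt_Suc_0[of d] by (simp add: D_def)
    have "multiplicity p d > 0"
      using d primepow_gt_Suc_0[of d] by (simp add: D_def)
    moreover have "multiplicity p d \<noteq> 1"
      using multiplicity_aprimedivisor_Suc_0_iff[of d] d np[of d] by (simp add: D_def)
    ultimately have "p ^ 2 \<le> p ^ multiplicity p d" using p by (intro power_increasing) auto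
    also have "\<dots> = d" using primepow_decompose[of d] d by (simp add: D_def)
    also have "\<dots> \<le> N" using d by (simp add: D_def)
    finally show ?thesis using p by simp
  qed
  have card: "aprimedivisor ` D \<subseteq> {1..nat \<lfloor>sqrt N\<rfloor>}"
  proof
    fix p assume "p \<in> aprimedivisor ` D"
    then have p: "p \<ge> 1" "p ^ 2 \<le> N" using * by auto
    have "real p ^ 2 \<le> N" using p(2) by (metis of_nat_le_iff of_nat_power)
    then have "real p \<le> sqrt N" by (rule real_le_rsqrt)
    then show "p \<in> {1..nat \<lfloor>sqrt N\<rfloor>}" using p(1) by (simp add: le_nat_floor)
  qed
  have "chebyshev_psi N - chebyshev_psi n = (\<Sum>d\<in>{1..N} - {1..n}. mangoldt d)"
    unfolding chebyshev_psi_def using assms by (subst sum_diff) auto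
  also have "{1..N} - {1..n} = {n<..N}" by auto
  also have "(\<Sum>d\<in>{n<..N}. mangoldt d) = (\<Sum>d\<in>D. ln (real (aprimedivisor d)))"
    unfolding D_def by (intro sum.mono_neutral_cong_right) (auto simp: mangoldt_def)
  also have "\<dots> = (\<Sum>p\<in>aprimedivisor ` D. ln (real p))"
  proof (subst sum.reindex)
    show "inj_on aprimedivisor D"
    proof (rule inj_onI)
      have le: "i \<le> j" if "n < p ^ i" "p ^ i \<le> N" "n < p ^ j" "p > 1" for p i j :: nat
      proof (rule ccontr)
        assume "\<not> i \<le> j"
        then have "p ^ Suc j \<le> p ^ i" using that by (intro power_increasing) auto
        moreover have "2 * p ^ j \<le> p ^ Suc j" using that by simp
        ultimately show False using that assms by linarith
      qed
      fix d e assume de: "d \<in> D" "e \<in> D" "aprimedivisor d = aprimedivisor e"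
      define p where "p = aprimedivisor d"
      obtain i j where ij: "d = p ^ i" "e = p ^ j"
        using de primepow_decompose unfolding D_def p_def by (metis (lifting) mem_Collect_eq)
      have "p > 1" unfolding p_def using de(1) primepow_gt_Suc_0[of d] by (simp add: D_def)
      with le[of p i j] le[of p j i] de ij have "i = j" by (auto simp: D_def)
      then show "d = e" using ij by simp
    qed
  qed simp
  also have "\<dots> \<le> (\<Sum>p\<in>aprimedivisor ` D. ln N / 2)"
  proof (rule sum_mono)
    fix p assume "p \<in> aprimedivisor ` D"
    then have p: "p \<ge> 1" "p ^ 2 \<le> N" using * by auto
    have "2 * ln (real p) = ln (real (p ^ 2))" using p by (simp add: ln_realpow)
    also have "\<dots> \<le> ln N" 
    proof (subst ln_le_cancel_iff)
      have "0 < p ^ 2" using p by simp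
      then show "0 < real (p ^ 2)" "0 < real N" "real (p ^ 2) \<le> real N"
        using p(2) by (simp_all only: of_nat_0_less_iff of_nat_le_iff)
    qed
    finally show "ln (real p) \<le> ln N / 2" by simp
  qed
  also have "(\<Sum>p\<in>aprimedivisor ` D. ln N / 2) = real (card (aprimedivisor ` D)) * (ln N / 2)"
    by simp
  also have "\<dots> \<le> sqrt N * (ln N / 2)"
  proof (rule mult_right_mono)
    have "card (aprimedivisor ` D) \<le> nat \<lfloor>sqrt N\<rfloor>" using card_mono[OF _ card] by simp
    also have "real (nat \<lfloor>sqrt N\<rfloor>) \<le> sqrt N" by simp
    finally show "real (card (aprimedivisor ` D)) \<le> sqrt N" by simp
    show "0 \<le> ln (real N) / 2" by (cases "N = 0") auto
  qed
  finally show ?thesis .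
qed

lemma ex_prime_three_halves_large:
  fixes n :: nat
  assumes n: "n \<ge> 10000"
  shows "\<exists>p. prime p \<and> n < p \<and> 2 * p < 3 * n"
proof (rule ccontr)
  assume contr: "\<not> ?thesis"
  \<comment> \<open>The largest integer strictly below \<open>3n/2\<close>.\<close>
  define N where "N = (3 * n - 1) div 2"
  have N: "n \<le> N" "N < 2 * n" "2 * N \<le> 3 * n" "3 * n \<le> 2 * N + 2"
    using n unfolding N_def by linarith+
  have no_prime: "N < p" if "prime p" "n < p" for p
  proof -
    have "3 * n \<le> 2 * p" using contr that by (meson not_less)
    then show ?thesis unfolding N_def using n by linarith
  qed
  \<comment> \<open>In terms of the fourth root, \<open>sqrt n\<close> becomes \<open>t ^ 2\<close>
    and logarithms get linear bounds, so the final comparison is between polynomials.\<close>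
  define t where "t = root 4 (real n)"
  have t4: "t ^ 4 = real n" by (simp add: t_def)
  have t: "t \<ge> 10"
  proof -
    have "root 4 (10 ^ 4) \<le> t" unfolding t_def using n by (subst real_root_le_iff) auto
    then show ?thesis by (simp add: real_root_power_cancel)
  qed
  \<comment> \<open>A common upper bound for all logarithms involved: \<open>ln 2 + 4 * ln t\<close>
    with \<open>ln 2 \<le> 1\<close> and \<open>ln t \<le> t / 8 + 2\<close>.\<close>
  define u where "u = 9 + t / 2"
  define l where "l = ln (real n + 1)"
  have l0: "l \<ge> 0" by (simp add: l_def)
  have ln2: "ln (2::real) \<le> 1" using ln_le_minus_one[of 2] by simp
  have "ln t = ln (t / 8) + 3 * ln 2"
    using t ln_realpow[of 2 3] by (simp add: ln_div)
  also have "\<dots> \<le> t / 8 + 2" using ln_le_minus_one[of "t / 8"] t ln2 by simp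
  finally have lnt: "ln t \<le> t / 8 + 2" .
  have "real N + 1 \<le> 2 * t ^ 4" using N n unfolding t4 by simp
  then have "ln (real N + 1) \<le> ln (2 * t ^ 4)" by (subst ln_le_cancel_iff) auto
  also have "\<dots> = ln 2 + 4 * ln t" using t by (simp add: ln_mult ln_realpow)
  also have "\<dots> \<le> u" using lnt ln2 by (simp add: u_def)
  finally have lN1: "ln (real N + 1) \<le> u" .
  have lN: "ln (real N) \<le> u" 
  proof -
    have "ln (real N) \<le> ln (real N + 1)" using N n by (subst ln_le_cancel_iff) auto
    then show ?thesis using lN1 by simp
  qed
  have "l \<le> ln (real N + 1)" unfolding l_def using N by (subst ln_le_cancel_iff) auto
  then have lu: "l \<le> u" using lN1 by simp
  \<comment> \<open>3/2 is rounded up to the square 25/16.\<close>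
  have "real N \<le> (5/4 * t ^ 2) ^ 2"
  proof -
    have "(5/4 * t ^ 2) ^ 2 = 25/16 * t ^ 4"
      by (simp add: power_mult_distrib power_divide flip: power_mult)
    then show ?thesis using N(3) t4 by simp
  qed
  then have sN: "sqrt (real N) \<le> 5/4 * t ^ 2" by (intro real_le_lsqrt) auto
  have "chebyshev_const * (real N - 6/5 * n) - 5 * ln (real N + 1) - 3 - (5 * l + 2) * (1 + l)
      \<le> chebyshev_psi N - chebyshev_psi n"
    using chebyshev_psi_ge[of N] chebyshev_psi_le[of n] N n
    unfolding l_def by (simp add: algebra_simps)
  also have "\<dots> \<le> sqrt N * (ln N / 2)"
    using N no_prime by (intro chebyshev_psi_diff_le_if_no_prime) auto
  also have "\<dots> \<le> (5/4 * t ^ 2) * (u / 2)"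
    using sN lN N n by (intro mult_mono) auto
  finally have 1: "chebyshev_const * (real N - 6/5 * n) - 5 * ln (real N + 1) - 3
      - (5 * l + 2) * (1 + l) \<le> (5/4 * t ^ 2) * (u / 2)" .
  have 2: "(5 * l + 2) * (1 + l) \<le> (5 * u + 2) * (1 + u)"
    using lu l0 by (intro mult_mono) auto
  \<comment> \<open>From \<open>N \<ge> 3n/2 - 1\<close> and 3/2 - 6/5 = 3/10.\<close>
  have "4/5 * (3/10 * real n - 1) \<le> chebyshev_const * (real N - 6/5 * n)"
    using chebyshev_const_ge N n by (intro mult_mono) auto
  then have 3: "4/5 * (3/10 * t ^ 4 - 1) \<le> chebyshev_const * (real N - 6/5 * n)"
    by (simp add: t4)
  have le: "4/5 * (3/10 * t ^ 4 - 1) - 5 * u - 3 - (5 * u + 2) * (1 + u) \<le> (5/4 * t ^ 2) * (u / 2)"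
    using 1 2 3 lN1 by linarith
  \<comment> \<open>Expanding around \<open>t = 10\<close> makes every coefficient positive, which
    contradicts \<open>le\<close>.\<close>
  define s where "s = t - 10"
  have s: "s \<ge> 0" "t = 10 + s" using t by (auto simp: s_def)
  have "4/5 * (3/10 * t ^ 4 - 1) - 5 * u - 3 - (5 * u + 2) * (1 + u) - (5/4 * t ^ 2) * (u / 2)
      = 1856/5 + 2711/4 * s + 511/4 * s ^ 2 + 743/80 * s ^ 3 + 6/25 * s ^ 4"
    unfolding u_def s(2) by (simp add: field_simps power_numeral_reduce)
  moreover have "s ^ 2 \<ge> 0" "s ^ 3 \<ge> 0" "s ^ 4 \<ge> 0" using s by auto
  ultimately show False using le s(1) by linarith
qed

text \<open>Trial division; the explicit list lets the simplifier run through the candidate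
  divisors.\<close>

lemma prime_if_no_small_divisor:
  fixes p k :: nat
  assumes "1 < p" "p < k * k" "\<forall>d\<in>set [2..<k]. \<not> d dvd p"
  shows "prime p"
  unfolding prime_divisor_sqrt
proof (intro conjI allI impI)
  show "p \<noteq> 1" using assms by simp
  fix d assume d: "d dvd p \<and> d\<^sup>2 \<le> p"
  then have "d * d < k * k" using assms by (simp add: power2_eq_square)
  then have "d < k" by (meson mult_le_mono not_le)
  moreover have "d > 0" using d assms by (auto intro!: Nat.gr0I)
  ultimately show "d = 1" using assms(3) d by (cases "d \<ge> 2") auto
qed

lemma ex_prime_three_halves:
  fixes n :: nat
  assumes n: "n \<ge> 8"
  shows "\<exists>p. prime p \<and> n < p \<and> 2 * p < 3 * n"
proof (cases "n \<ge> 10000")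
  case True
  then show ?thesis by (rule ex_prime_three_halves_large)
next
  case False
  \<comment> \<open>If \<open>q' \<le> n\<close> and \<open>n < q\<close>, then \<open>q\<close> is
    itself a witness, as \<open>2 * q < 3 * q'\<close> and \<open>q' \<le> n\<close>.\<close>
  have step: "n < q \<longrightarrow> (\<exists>p. prime p \<and> n < p \<and> 2 * p < 3 * n)"
    if "n < q' \<longrightarrow> (\<exists>p. prime p \<and> n < p \<and> 2 * p < 3 * n)" "prime q" "2 * q < 3 * q'"
    for q q' :: nat
    using that by (cases "n < q'") (auto intro!: exI[of _ q])
  have "n < 8 \<longrightarrow> ?thesis" using n by simp
  then have "n < 11 \<longrightarrow> ?thesis" by (rule step) simp_all
  then have "n < 13 \<longrightarrow> ?thesis" by (rule step) simp_all
  then have "n < 19 \<longrightarrow> ?thesis" by (rule step) simp_all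
  then have "n < 23 \<longrightarrow> ?thesis" by (rule step) simp_all
  then have "n < 31 \<longrightarrow> ?thesis" by (rule step) simp_all
  then have "n < 43 \<longrightarrow> ?thesis" by (rule step) simp_all
  then have "n < 61 \<longrightarrow> ?thesis" by (rule step) simp_all
  then have "n < 89 \<longrightarrow> ?thesis" by (rule step) simp_all
  then have "n < 131 \<longrightarrow> ?thesis" by (rule step) simp_all
  then have "n < 193 \<longrightarrow> ?thesis" by (rule step) simp_all
  then have "n < 283 \<longrightarrow> ?thesis" by (rule step) simp_all
  then have "n < 421 \<longrightarrow> ?thesis" by (rule step) simp_all
  \<comment> \<open>From here on primality is shown by trial division below a \<open>k\<close> whose
    square exceeds the prime, here 26 with 676 > 631.\<close>
  then have "n < 631 \<longrightarrow> ?thesis"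
    by (rule step[OF _ prime_if_no_small_divisor[of _ 26]]) simp_all
  then have "n < 941 \<longrightarrow> ?thesis"
    by (rule step[OF _ prime_if_no_small_divisor[of _ 31]]) simp_all
  then have "n < 1409 \<longrightarrow> ?thesis"
    by (rule step[OF _ prime_if_no_small_divisor[of _ 38]]) simp_all
  then have "n < 2113 \<longrightarrow> ?thesis"
    by (rule step[OF _ prime_if_no_small_divisor[of _ 46]]) simp_all
  then have "n < 3169 \<longrightarrow> ?thesis"
    by (rule step[OF _ prime_if_no_small_divisor[of _ 57]]) simp_all
  then have "n < 4751 \<longrightarrow> ?thesis"
    by (rule step[OF _ prime_if_no_small_divisor[of _ 69]]) simp_all
  then have "n < 7121 \<longrightarrow> ?thesis"
    by (rule step[OF _ prime_if_no_small_divisor[of _ 85]]) simp_all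
  then have "n < 10667 \<longrightarrow> ?thesis"
    by (rule step[OF _ prime_if_no_small_divisor[of _ 104]]) simp_all
  then show ?thesis using False by simp
qed

section \<open>Perfect powers between \<open>3n/2\<close> and \<open>2n\<close>, and the
  conclusion\<close>

lemma ex_nat_power_between:
  fixes x y :: real
  assumes "m > 0" "x \<ge> 0" "root m x + 1 < root m y"
  shows "\<exists>a::nat. a > 0 \<and> x < real a ^ m \<and> real a ^ m < y"
proof -
  \<comment> \<open>Floor plus one, rather than the ceiling, stays strictly above
    \<open>root m x\<close> even if that root is an integer.\<close>
  define a where "a = nat \<lfloor>root m x\<rfloor> + 1"
  have r: "root m x \<ge> 0" using assms by simp
  have a: "root m x < real a" "real a \<le> root m x + 1" unfolding a_def using r by linarith+
  have y: "y > 0" using assms r by (metis add_nonneg_pos less_trans not_less real_root_gt_0_iff zero_less_one)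
  have "x = root m x ^ m" using assms by simp
  also have "\<dots> < real a ^ m" using a r assms by (intro power_strict_mono) auto
  finally have "x < real a ^ m" .
  moreover have "real a ^ m < root m y ^ m" using a assms by (intro power_strict_mono) auto
  then have "real a ^ m < y" using y assms by simp
  ultimately show ?thesis by (intro exI[of _ a]) (auto simp: a_def)
qed

theorem theorem8p4:
  fixes m n :: nat
  assumes "m > 0" and "n > 0"
    and "real n > 14.4 / (root m 2 - root m 1.5) ^ m"
  shows "\<exists>r a :: nat. prime r \<and> a > 0 \<and>
           n < r \<and> real r < 3 * real n / 2 \<and>
           3 * real n / 2 < real (a ^ m) \<and> a ^ m < 2 * n"
proof -
  define \<delta> where "\<delta> = root m 2 - root m 1.5"
  have \<delta>0: "\<delta> > 0" using assms(1) by (simp add: \<delta>_def)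
  \<comment> \<open>Bounding \<open>\<delta>\<close> by 1 turns the hypothesis into
    \<open>n > 14.4\<close>, enough for the existence of the prime.\<close>
  have "root m 2 \<le> root m (2 ^ m)"
    using assms(1) power_increasing[of 1 m "2::real"] by (subst real_root_le_iff) auto
  then have "root m 2 \<le> 2" using assms(1) by (simp add: real_root_power_cancel)
  moreover have "root m 1.5 \<ge> 1" using assms(1) by simp
  ultimately have "\<delta> \<le> 1" by (simp add: \<delta>_def)
  then have \<delta>1: "\<delta> ^ m \<le> 1" using \<delta>0 by (intro power_le_one) auto
  have n\<delta>: "14.4 < real n * \<delta> ^ m"
    using assms(3) \<delta>0 unfolding \<delta>_def[symmetric] by (simp add: field_simps)
  also have "\<dots> \<le> real n" using \<delta>1 by (simp add: mult_left_le)
  finally have "n \<ge> 8" by simp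
  then obtain r where r: "prime r" "n < r" "2 * r < 3 * n" using ex_prime_three_halves by blast
  \<comment> \<open>By homogeneity of the root, \<open>root m n * \<delta>\<close> is exactly the
    gap between the roots of \<open>2n\<close> and \<open>3n/2\<close>.\<close>
  have "1 < root m (real n * \<delta> ^ m)" using n\<delta> assms(1) by simp
  also have "\<dots> = root m n * \<delta>"
    using assms(1) \<delta>0 by (simp add: real_root_mult real_root_power_cancel)
  also have "\<dots> = root m (2 * real n) - root m (3 * real n / 2)"
    using real_root_mult[of m "1.5" n] real_root_mult[of m 2 n] by (simp add: \<delta>_def algebra_simps)
  finally obtain a :: nat where a: "a > 0" "3 * real n / 2 < real a ^ m" "real a ^ m < 2 * real n"
    using ex_nat_power_between[of m "3 * real n / 2" "2 * real n"] assms(1) by auto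
  have "real (a ^ m) < real (2 * n)" using a by simp
  then have "a ^ m < 2 * n" by (simp only: of_nat_less_iff)
  moreover have "real r < 3 * real n / 2" using r(3) by linarith
  ultimately show ?thesis using r a by (intro exI[of _ r] exI[of _ a]) auto
qed

end
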